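(* Let $k\in\mathbb N$, $k\geq 1$, and let $\Omega\subseteq\mathbb R^2$ be open with $0\in\Omega$. Then there exists no solution $u\in\mathcal B_k(\Omega\cap\mathbb R^2_+)$ of the partial differential equation $$-\Delta u=0\ \text{ in }\Omega\cap\mathbb R^2_+,\qquad u=\sigma_k(x_1)\ \text{ on }\Omega\cap\partial\mathbb R^2_+,$$ where $x_1$ denotes the first coordinate.
   Context: $\mathbb R^2_+=\{(x_1,x_2)\in\mathbb R^2: x_2>0\}$. For $\alpha>0$ let $\sigma_\alpha(z)=\max\{z,0\}^\alpha$ for $z\in\mathbb R$. For a Borel probability measure $\pi$ on $\mathbb R\times\mathbb R^d\times\mathbb R$ set $f_{\pi,\alpha}(x)=\mathbb E_{(a,w,b)\sim\pi}[a\,\sigma_\alpha(w^Tx+b)]$, $x\in\mathbb R^d$. For $D\subseteq\mathbb R^d$ and a continuous function $f:D\to\mathbb R$, $$\|f\|_{\mathcal B_\alpha(D)}=\inf\{\mathbb E_{(a,w,b)\sim\pi}[|a|(|w|+|b|)^\alpha] : f(x)=f_{\pi,\alpha}(x)\text{ for all }x\in D\},$$ and $\mathcal B_\alpha(D)=\{f\in C^0(D):\|f\|_{\mathcal B_\alpha(D)}<\infty\}$. Boundary values are understood as those of the continuous extension of $u$ to $\Omega\cap\overline{\mathbb R^2_+}$. *)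

theory Defs
  imports "HOL-Probability.Probability"
begin

definition upper_half_plane :: "(real^2) set" where
  "upper_half_plane = {x. x $ 2 > 0}"

definition relu_pow :: "real \<Rightarrow> real \<Rightarrow> real" where
  "relu_pow \<alpha> z = max z 0 powr \<alpha>"

definition network :: "real \<Rightarrow> (real \<times> 'a \<times> real) measure \<Rightarrow> 'a::euclidean_space \<Rightarrow> real" where
  "network \<alpha> \<pi> x = (\<integral>(a, w, b). a * relu_pow \<alpha> (w \<bullet> x + b) \<partial>\<pi>)"

definition barron_cost :: "real \<Rightarrow> (real \<times> 'a::euclidean_space \<times> real) measure \<Rightarrow> ennreal" where
  "barron_cost \<alpha> \<pi> = (\<integral>\<^sup>+(a, w, b). ennreal (\<bar>a\<bar> * (norm w + \<bar>b\<bar>) powr \<alpha>) \<partial>\<pi>)"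

text \<open>
  Functions on D are total functions of which only the values on D matter. The infimum
  is taken in the extended nonnegative reals, so it is infinite if no representing measure exists.
  For \<alpha> > 0, a measure of finite cost makes the integrand of \<^const>\<open>network\<close> integrable at
  every point, so measures for which \<^const>\<open>network\<close> takes the default value 0 of the
  Bochner integral have infinite cost and do not affect the infimum.
\<close>
definition barron_norm :: "real \<Rightarrow> 'a::euclidean_space set \<Rightarrow> ('a \<Rightarrow> real) \<Rightarrow> ennreal" where
  "barron_norm \<alpha> D f =
     (INF \<pi> \<in> {\<pi>. prob_space \<pi> \<and> sets \<pi> = sets borel \<and> (\<forall>x\<in>D. f x = network \<alpha> \<pi> x)}.
        barron_cost \<alpha> \<pi>)"

definition barron_space :: "real \<Rightarrow> 'a::euclidean_space set \<Rightarrow> ('a \<Rightarrow> real) set" where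
  "barron_space \<alpha> D = {f. continuous_on D f \<and> barron_norm \<alpha> D f < \<infinity>}"

definition partial_deriv :: "'a \<Rightarrow> ('a::euclidean_space \<Rightarrow> real) \<Rightarrow> 'a \<Rightarrow> real" where
  "partial_deriv i f x = frechet_derivative f (at x) i"

text \<open>The next two predicates are meant for open S.\<close>
definition C1_on :: "'a::euclidean_space set \<Rightarrow> ('a \<Rightarrow> real) \<Rightarrow> bool" where
  "C1_on S f \<longleftrightarrow> f differentiable_on S \<and> (\<forall>i\<in>Basis. continuous_on S (partial_deriv i f))"

definition C2_on :: "'a::euclidean_space set \<Rightarrow> ('a \<Rightarrow> real) \<Rightarrow> bool" where
  "C2_on S f \<longleftrightarrow> f differentiable_on S \<and> (\<forall>i\<in>Basis. C1_on S (partial_deriv i f))"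

definition laplacian :: "('a::euclidean_space \<Rightarrow> real) \<Rightarrow> 'a \<Rightarrow> real" where
  "laplacian f x = (\<Sum>i\<in>Basis. partial_deriv i (partial_deriv i f) x)"

text \<open>
  Classical solutions of the Dirichlet problem in \<Omega> \<inter> H with data g on \<Omega> \<inter> frontier H, attained
  by the continuous extension U of u.
\<close>
definition solves_dirichlet ::
    "'a::euclidean_space set \<Rightarrow> 'a set \<Rightarrow> ('a \<Rightarrow> real) \<Rightarrow> ('a \<Rightarrow> real) \<Rightarrow> bool" where
  "solves_dirichlet \<Omega> H g u \<longleftrightarrow>
     C2_on (\<Omega> \<inter> H) u \<and>
     (\<forall>x \<in> \<Omega> \<inter> H. - laplacian u x = 0) \<and>
     (\<exists>U. continuous_on (\<Omega> \<inter> closure H) U \<and>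
          (\<forall>x \<in> \<Omega> \<inter> H. U x = u x) \<and>
          (\<forall>x \<in> \<Omega> \<inter> frontier H. U x = g x))"

end

(* Let g(r) be the integral of u(r e^(it)) sin(k t) over 0 < t < pi. Since the boundary datum
   x_+^k resonates with the harmonic polynomial Im z^k, harmonicity forces
   g(r) = r^k (B - (ln r) / 2) for a constant B. A Barron function, on the other hand, is an average of
   ridge functions max(w.x + b, 0)^k; near the origin each of them is a polynomial of degree k unless
   |b| is of the order |w||x|. Hence a combination of dilations that annihilates all homogeneous
   functions of degree < k maps it to a function of size O(|x|^k), whereas the same combination of
   g(2^m r) is still of exact order r^k |ln r|. *)
theory Submission
  imports Defs "HOL-Complex_Analysis.Complex_Analysis"
begin

subsection \<open>Planar harmonic functions as real parts\<close>

text \<open>Separation in polar coordinates suggests r^2 g_rr + r g_r - k^2 g = -k r^k: the right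
  side is the boundary term at angle 0 (the one at angle pi vanishes), and it is proportional to the
  homogeneous solution r^k, hence the logarithm with factor -1/2. Continuity at 0 excludes the other
  solution r^(-k). This remains a heuristic, because the solution is merely continuous up to the
  boundary: neither its gradient nor its harmonic conjugate is controlled there. The proof therefore
  uses integrated identities for a holomorphic function on contours inside the domain, arranged so
  that only values of the solution survive when the contours reach the boundary. On the Barron side,
  no O(|x|^k) bound holds for the function itself, as biases contribute terms of lower degree in x.
  Dilation combinations remove them for each neuron separately, without differentiating the
  expectation. They also suit the logarithm, since ln(2^m r) differs from ln r by a
  constant.\<close>

lemma mixed_difference_mean_value:
  fixes v vx vxy :: "real \<Rightarrow> real \<Rightarrow> real"
  assumes "d > 0"
    and vx: "\<And>x y. \<lbrakk>x0 \<le> x; x \<le> x0 + d; y0 \<le> y; y \<le> y0 + d\<rbrakk>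
               \<Longrightarrow> ((\<lambda>x. v x y) has_real_derivative vx x y) (at x)"
    and vxy: "\<And>x y. \<lbrakk>x0 \<le> x; x \<le> x0 + d; y0 \<le> y; y \<le> y0 + d\<rbrakk>
               \<Longrightarrow> ((\<lambda>y. vx x y) has_real_derivative vxy x y) (at y)"
  obtains x y where "x0 < x" "x < x0 + d" "y0 < y" "y < y0 + d"
    "v (x0 + d) (y0 + d) - v (x0 + d) y0 - v x0 (y0 + d) + v x0 y0 = d * d * vxy x y"
proof -
  have "\<exists>x. x > x0 \<and> x < x0 + d \<and>
      (v (x0 + d) (y0 + d) - v (x0 + d) y0) - (v x0 (y0 + d) - v x0 y0)
        = (x0 + d - x0) * (vx x (y0 + d) - vx x y0)"
    using \<open>d > 0\<close> by (intro MVT2 DERIV_diff vx) auto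
  then obtain x where x: "x0 < x" "x < x0 + d"
    "v (x0 + d) (y0 + d) - v (x0 + d) y0 - (v x0 (y0 + d) - v x0 y0)
       = d * (vx x (y0 + d) - vx x y0)" by auto
  have "\<exists>y. y > y0 \<and> y < y0 + d \<and> vx x (y0 + d) - vx x y0 = (y0 + d - y0) * vxy x y"
    using \<open>d > 0\<close> x by (intro MVT2 vxy) auto
  then obtain y where "y0 < y" "y < y0 + d" "vx x (y0 + d) - vx x y0 = d * vxy x y" by auto
  with x show ?thesis by (intro that[of x y]) (auto simp: algebra_simps)
qed

lemma has_derivative_Re_line:
  assumes "(f has_derivative (\<lambda>h. a * Re h + b * Im h)) (at (Complex x y))"
  shows "((\<lambda>x. f (Complex x y)) has_real_derivative a) (at x)"
proof -
  have *: "((\<lambda>x. Complex x y) has_derivative (\<lambda>h. Complex h 0)) (at x)"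
    unfolding Complex_eq by (auto intro!: derivative_eq_intros)
  show ?thesis
    unfolding has_field_derivative_def
    using has_derivative_compose[OF * assms] by simp
qed

lemma has_derivative_Im_line:
  assumes "(f has_derivative (\<lambda>h. a * Re h + b * Im h)) (at (Complex x y))"
  shows "((\<lambda>y. f (Complex x y)) has_real_derivative b) (at y)"
proof -
  have *: "((\<lambda>y. Complex x y) has_derivative (\<lambda>h. Complex 0 h)) (at y)"
    unfolding Complex_eq by (auto intro!: derivative_eq_intros)
  show ?thesis
    unfolding has_field_derivative_def
    using has_derivative_compose[OF * assms] by simp
qed

text \<open>The second difference of \<open>v\<close> over a small square can be evaluated by two
  mean value steps in either order of the coordinates. This gives the same number as a value of
  \<open>vxy\<close> and as a value of \<open>vyx\<close> near \<open>z0\<close>; continuity does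
  the rest.\<close>

lemma symmetric_mixed_partials:
  fixes v vx vy vxx vxy vyx vyy :: "complex \<Rightarrow> real"
  assumes "open S" "z0 \<in> S"
    and v: "\<And>z. z \<in> S \<Longrightarrow> (v has_derivative (\<lambda>h. vx z * Re h + vy z * Im h)) (at z)"
    and vx: "\<And>z. z \<in> S \<Longrightarrow> (vx has_derivative (\<lambda>h. vxx z * Re h + vxy z * Im h)) (at z)"
    and vy: "\<And>z. z \<in> S \<Longrightarrow> (vy has_derivative (\<lambda>h. vyx z * Re h + vyy z * Im h)) (at z)"
    and cont: "continuous_on S vxy" "continuous_on S vyx"
  shows "vxy z0 = vyx z0"
proof (rule ccontr)
  assume "vxy z0 \<noteq> vyx z0"
  \<comment> \<open>Half the gap, so that the open \<open>e\<close>-neighbourhoods of the two values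
    are disjoint.\<close>
  define e where "e = \<bar>vxy z0 - vyx z0\<bar> / 2"
  have "e > 0" using \<open>vxy z0 \<noteq> vyx z0\<close> by (simp add: e_def)
  obtain r where r: "r > 0" "ball z0 r \<subseteq> S"
    using assms(1,2) openE by blast
  have "isCont vxy z0" "isCont vyx z0"
    using cont assms(1,2) continuous_on_eq_continuous_at by blast+
  then obtain s t where s: "s > 0" "\<And>z. dist z z0 < s \<Longrightarrow> dist (vxy z) (vxy z0) < e"
    and t: "t > 0" "\<And>z. dist z z0 < t \<Longrightarrow> dist (vyx z) (vyx z0) < e"
    using \<open>e > 0\<close> unfolding continuous_at_eps_delta by (metis (no_types))
  \<comment> \<open>Points of the square of side \<open>d\<close> are within 2 d of
    \<open>z0\<close>, so the divisor 3 leaves room in all three radii.\<close>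
  define d where "d = min r (min s t) / 3"
  have d: "d > 0" "2 * d < r" "2 * d < s" "2 * d < t"
    using r s t by (auto simp: d_def min_def field_simps)
  have near: "dist (Complex x y) z0 \<le> 2 * d"
    if "Re z0 \<le> x" "x \<le> Re z0 + d" "Im z0 \<le> y" "y \<le> Im z0 + d" for x y
    using cmod_le[of "Complex x y - z0"] that by (simp add: dist_norm)
  have inS: "Complex x y \<in> S"
    if "Re z0 \<le> x" "x \<le> Re z0 + d" "Im z0 \<le> y" "y \<le> Im z0 + d" for x y
    using near[OF that] r d by (auto simp: dist_commute)
  obtain x y where 1: "Re z0 < x" "x < Re z0 + d" "Im z0 < y" "y < Im z0 + d"
    "v (Complex (Re z0 + d) (Im z0 + d)) - v (Complex (Re z0 + d) (Im z0))
       - v (Complex (Re z0) (Im z0 + d)) + v (Complex (Re z0) (Im z0)) = d * d * vxy (Complex x y)"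
    by (rule mixed_difference_mean_value[of d "Re z0" "Im z0" "\<lambda>x y. v (Complex x y)"
          "\<lambda>x y. vx (Complex x y)" "\<lambda>x y. vxy (Complex x y)"])
       (use d in \<open>auto intro: has_derivative_Re_line[OF v] has_derivative_Im_line[OF vx] inS\<close>)
  obtain y' x' where 2: "Im z0 < y'" "y' < Im z0 + d" "Re z0 < x'" "x' < Re z0 + d"
    "v (Complex (Re z0 + d) (Im z0 + d)) - v (Complex (Re z0) (Im z0 + d))
       - v (Complex (Re z0 + d) (Im z0)) + v (Complex (Re z0) (Im z0)) = d * d * vyx (Complex x' y')"
    by (rule mixed_difference_mean_value[of d "Im z0" "Re z0" "\<lambda>y x. v (Complex x y)"
          "\<lambda>y x. vy (Complex x y)" "\<lambda>y x. vyx (Complex x y)"])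
       (use d in \<open>auto intro: has_derivative_Im_line[OF v] has_derivative_Re_line[OF vy] inS\<close>)
  have "d * d * vxy (Complex x y) = d * d * vyx (Complex x' y')" using 1(5) 2(5) by linarith
  then have "vxy (Complex x y) = vyx (Complex x' y')" using d by simp
  moreover have "dist (vxy (Complex x y)) (vxy z0) < e"
    using near[of x y] 1 d by (intro s) auto
  moreover have "dist (vyx (Complex x' y')) (vyx z0) < e"
    using near[of x' y'] 2 d by (intro t) auto
  ultimately show False unfolding e_def dist_real_def by (simp add: abs_if split: if_splits)
qed

text \<open>Harmonicity and the symmetry of mixed partials are the Cauchy-Riemann equations for the
  complex gradient \<open>q\<close>. Convexity supplies a primitive, whose real part has the
  gradient of \<open>v\<close> and so differs from \<open>v\<close> by a constant.\<close>

lemma harmonic_eq_Re_holomorphic: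
  fixes v vx vy vxx vxy vyx vyy :: "complex \<Rightarrow> real"
  assumes "open S" "convex S"
    and v: "\<And>z. z \<in> S \<Longrightarrow> (v has_derivative (\<lambda>h. vx z * Re h + vy z * Im h)) (at z)"
    and vx: "\<And>z. z \<in> S \<Longrightarrow> (vx has_derivative (\<lambda>h. vxx z * Re h + vxy z * Im h)) (at z)"
    and vy: "\<And>z. z \<in> S \<Longrightarrow> (vy has_derivative (\<lambda>h. vyx z * Re h + vyy z * Im h)) (at z)"
    and cont: "continuous_on S vxy" "continuous_on S vyx"
    and harm: "\<And>z. z \<in> S \<Longrightarrow> vxx z + vyy z = 0"
  obtains F where "F holomorphic_on S" "\<And>z. z \<in> S \<Longrightarrow> Re (F z) = v z"
proof -
  \<comment> \<open>Twice the Wirtinger derivative of \<open>v\<close>, that is, the complex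
    derivative of the function sought.\<close>
  define q where "q = (\<lambda>z. of_real (vx z) - \<i> * of_real (vy z))"
  have q: "(q has_field_derivative Complex (vxx z) (- vyx z)) (at z)" if z: "z \<in> S" for z
  proof (rule has_derivative_imp_has_field_derivative)
    show "(q has_derivative (\<lambda>h. of_real (vxx z * Re h + vxy z * Im h)
              - \<i> * of_real (vyx z * Re h + vyy z * Im h))) (at z)"
      unfolding q_def by (intro derivative_intros vx vy z)
    have "vxy z = vyx z" using symmetric_mixed_partials[OF assms(1) z v vx vy cont] by blast
    moreover have "vyy z = - vxx z" using harm[OF z] by simp
    ultimately show "h * Complex (vxx z) (- vyx z) = of_real (vxx z * Re h + vxy z * Im h)
              - \<i> * of_real (vyx z * Re h + vyy z * Im h)" for h
      by (simp add: complex_eq_iff algebra_simps)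
  qed
  then have "q holomorphic_on S"
    using assms(1) holomorphic_on_open by blast
  then obtain G where G: "\<And>z. z \<in> S \<Longrightarrow> (G has_field_derivative q z) (at z within S)"
    by (rule holomorphic_convex_primitive'[OF assms(2,1)]) blast
  have "((\<lambda>z. Re (G z) - v z) has_derivative (\<lambda>h. 0)) (at z within S)" if z: "z \<in> S" for z
  proof -
    have "((\<lambda>z. Re (G z) - v z) has_derivative
             (\<lambda>h. Re (q z * h) - (vx z * Re h + vy z * Im h))) (at z within S)"
      using G[OF z] z by (intro has_derivative_diff has_derivative_Re has_derivative_at_withinI[OF v])
        (auto simp: has_field_derivative_def)
    then show ?thesis by (simp add: q_def algebra_simps)
  qed
  then obtain c where c: "\<And>z. z \<in> S \<Longrightarrow> Re (G z) - v z = c"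
    using has_derivative_zero_constant[OF assms(2), of "\<lambda>z. Re (G z) - v z"] by blast
  show ?thesis
  proof
    show "(\<lambda>z. G z - of_real c) holomorphic_on S"
      using G by (intro holomorphic_intros) (auto simp: holomorphic_on_def field_differentiable_def)
    show "Re (G z - of_real c) = v z" if "z \<in> S" for z
      using c[OF that] by simp
  qed
qed

subsection \<open>The sine moment on half circles\<close>

text \<open>A contour integral over the upper half circle with dz = i z dt written out. The values
  of a primitive at the endpoints link arcs to real segments, so no closed contour has to be
  formed.\<close>

lemma has_integral_primitive_arc:
  fixes P f :: "complex \<Rightarrow> complex"
  assumes P: "\<And>z. z \<in> S \<Longrightarrow> (P has_field_derivative f z) (at z)"
    and sub: "\<And>t. \<lbrakk>0 \<le> t; t \<le> pi\<rbrakk> \<Longrightarrow> of_real r * cis t \<in> S"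
  shows "((\<lambda>t. \<i> * (of_real r * cis t) * f (of_real r * cis t)) has_integral
           P (- of_real r) - P (of_real r)) {0..pi}"
proof -
  have "((\<lambda>t. P (of_real r * cis t)) has_vector_derivative
          \<i> * (of_real r * cis t) * f (of_real r * cis t)) (at t within {0..pi})" if "t \<in> {0..pi}" for t
  proof -
    have "((\<lambda>t. of_real r * cis t) has_vector_derivative \<i> * (of_real r * cis t)) (at t within {0..pi})"
      unfolding has_vector_derivative_def
      by (auto intro!: derivative_eq_intros simp: scaleR_conv_of_real)
    from field_vector_diff_chain_within[OF this has_field_derivative_at_within[OF P]] sub that
    show ?thesis by (auto simp: o_def)
  qed
  from fundamental_theorem_of_calculus[OF _ this] show ?thesis by simp
qed

lemma has_integral_primitive_real_line:
  fixes P f :: "complex \<Rightarrow> complex"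
  assumes P: "\<And>z. z \<in> S \<Longrightarrow> (P has_field_derivative f z) (at z)"
    and sub: "\<And>x. \<lbrakk>a \<le> x; x \<le> b\<rbrakk> \<Longrightarrow> of_real x \<in> S" and "a \<le> b"
  shows "((\<lambda>x. f (of_real x)) has_integral P (of_real b) - P (of_real a)) {a..b}"
proof -
  have "((\<lambda>x. P (of_real x)) has_vector_derivative f (of_real x)) (at x within {a..b})"
    if "x \<in> {a..b}" for x
  proof -
    have "((\<lambda>x::real. complex_of_real x) has_vector_derivative 1) (at x within {a..b})"
      by (auto intro!: derivative_eq_intros)
    from field_vector_diff_chain_within[OF this has_field_derivative_at_within[OF P]] sub that
    show ?thesis by (auto simp: o_def)
  qed
  from fundamental_theorem_of_calculus[OF \<open>a \<le> b\<close> this] show ?thesis .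
qed

lemma Re_i_mult_cis: "Re (\<i> * w * of_real a * cis s) = - a * (Re w * sin s + Im w * cos s)"
  by (simp add: algebra_simps)

text \<open>Cauchy's theorem for \<open>F z * z ^ (k - 1)\<close> on the half disc and for \<open>F z / z ^ (k + 1)\<close> on the
  half annulus: together they determine the sine moment of \<open>Re F\<close> on half circles without reference to
  the boundary values of \<open>Im F\<close>, over which there is no control.\<close>

lemma half_disc_sector_identity:
  fixes F :: "complex \<Rightarrow> complex" and k :: nat
  assumes F: "F holomorphic_on {z. norm z < \<rho> \<and> Im z > - e}"
    and "e > 0" "k \<ge> 1" "0 < r" "r < \<rho>"
  shows "integral {0..pi} (\<lambda>t. Re (F (of_real r * cis t)) * sin (real k * t))
       + integral {0..pi} (\<lambda>t. Im (F (of_real r * cis t)) * cos (real k * t))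
       = integral {-r..r} (\<lambda>x. Re (F (of_real x)) * x ^ (k - 1)) / r ^ k"
proof -
  define S where "S = {z. norm z < \<rho> \<and> Im z > - e}"
  have S: "S = ball 0 \<rho> \<inter> {z. Im z > - e}" by (auto simp: S_def)
  have "convex S" "open S"
    unfolding S by (auto intro!: convex_Int convex_halfspace_Im_gt open_halfspace_Im_gt)
  have "(\<lambda>z. F z * z ^ (k - 1)) holomorphic_on S"
    using F unfolding S_def by (intro holomorphic_intros)
  then obtain P where "\<And>z. z \<in> S \<Longrightarrow> (P has_field_derivative F z * z ^ (k - 1)) (at z within S)"
    by (rule holomorphic_convex_primitive'[OF \<open>convex S\<close> \<open>open S\<close>]) blast
  then have P: "\<And>z. z \<in> S \<Longrightarrow> (P has_field_derivative F z * z ^ (k - 1)) (at z)"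
    using \<open>open S\<close> by (metis at_within_open)
  have arcS: "of_real r * cis t \<in> S" if "0 \<le> t" "t \<le> pi" for t
  proof -
    have "0 \<le> r * sin t" using that \<open>0 < r\<close> by (simp add: sin_ge_zero)
    then show ?thesis using assms by (simp add: S_def norm_mult)
  qed
  have "((\<lambda>t. \<i> * (of_real r * cis t) * (F (of_real r * cis t) * (of_real r * cis t) ^ (k - 1)))
          has_integral P (- of_real r) - P (of_real r)) {0..pi}"
    by (rule has_integral_primitive_arc[OF P arcS])
  \<comment> \<open>The factor z from dz raises z^(k-1) to z^k, whose argument on the arc is k t;
    this is the source of the frequency \<open>k\<close>.\<close>
  also have "(\<lambda>t. \<i> * (of_real r * cis t) * (F (of_real r * cis t) * (of_real r * cis t) ^ (k - 1)))
      = (\<lambda>t. \<i> * F (of_real r * cis t) * of_real (r ^ k) * cis (real k * t))"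
  proof
    fix t
    have "(of_real r * cis t) * (of_real r * cis t) ^ (k - 1) = (of_real r * cis t) ^ k"
      using \<open>k \<ge> 1\<close> by (metis mult.commute power_minus_mult less_eq_Suc_le One_nat_def)
    also have "\<dots> = of_real (r ^ k) * cis (real k * t)"
      by (simp add: power_mult_distrib Complex.DeMoivre)
    finally have eq: "(of_real r * cis t) * (of_real r * cis t) ^ (k - 1) = of_real (r ^ k) * cis (real k * t)" .
    have "\<i> * (of_real r * cis t) * (F (of_real r * cis t) * (of_real r * cis t) ^ (k - 1))
       = \<i> * F (of_real r * cis t) * ((of_real r * cis t) * (of_real r * cis t) ^ (k - 1))"
      by (simp only: mult_ac)
    then show "\<i> * (of_real r * cis t) * (F (of_real r * cis t) * (of_real r * cis t) ^ (k - 1))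
       = \<i> * F (of_real r * cis t) * of_real (r ^ k) * cis (real k * t)"
      unfolding eq by (simp only: mult.assoc)
  qed
  finally have arc: "((\<lambda>t. \<i> * F (of_real r * cis t) * of_real (r ^ k) * cis (real k * t))
          has_integral P (- of_real r) - P (of_real r)) {0..pi}" .
  have realS: "of_real x \<in> S" if "\<bar>x\<bar> \<le> r" for x
    using that assms by (simp add: S_def)
  have line: "((\<lambda>x. F (of_real x) * of_real x ^ (k - 1)) has_integral P (of_real r) - P (of_real (-r))) {-r..r}"
    by (rule has_integral_primitive_real_line[OF P]) (use \<open>0 < r\<close> in \<open>auto intro!: realS\<close>)
  have line': "integral {-r..r} (\<lambda>x. Re (F (of_real x)) * x ^ (k - 1)) = Re (P (of_real r)) - Re (P (- of_real r))"
  proof (rule integral_unique)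
    show "((\<lambda>x. Re (F (of_real x)) * x ^ (k - 1)) has_integral Re (P (of_real r)) - Re (P (- of_real r))) {-r..r}"
      using has_integral_Re[OF line] by (simp flip: of_real_power)
  qed
  have cont: "continuous_on {0..pi} (\<lambda>t. F (of_real r * cis t))"
    using F arcS
    by (intro continuous_on_compose2[OF holomorphic_on_imp_continuous_on[OF F]] continuous_intros)
       (auto simp: S_def)
  have "integral {0..pi} (\<lambda>t. Re (F (of_real r * cis t)) * sin (real k * t))
       + integral {0..pi} (\<lambda>t. Im (F (of_real r * cis t)) * cos (real k * t))
      = integral {0..pi} (\<lambda>t. Re (F (of_real r * cis t)) * sin (real k * t)
           + Im (F (of_real r * cis t)) * cos (real k * t))"
    by (intro integral_add[symmetric] integrable_continuous_real continuous_intros cont)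
  also have "\<dots> = (Re (P (of_real r)) - Re (P (- of_real r))) / r ^ k"
  proof (rule integral_unique)
    have "Re (\<i> * w * of_real (r ^ k) * cis s) * (- 1 / r ^ k) = Re w * sin s + Im w * cos s" for w s
      using \<open>0 < r\<close> by (simp add: Re_i_mult_cis) (simp add: field_simps)
    moreover have "(Re (P (- of_real r)) - Re (P (of_real r))) * (- 1 / r ^ k)
        = (Re (P (of_real r)) - Re (P (- of_real r))) / r ^ k"
      using \<open>0 < r\<close> by (simp add: field_simps)
    ultimately show "((\<lambda>t. Re (F (of_real r * cis t)) * sin (real k * t)
           + Im (F (of_real r * cis t)) * cos (real k * t)) has_integral
           (Re (P (of_real r)) - Re (P (- of_real r))) / r ^ k) {0..pi}"
      using has_integral_mult_left[OF has_integral_Re[OF arc], of "- 1 / r ^ k"]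
      by (simp only: minus_complex.sel)
  qed
  finally show ?thesis using line' by simp
qed

text \<open>The kernel z^(-k-1) puts frequency -k on the arc, so the cosine moment of
  \<open>Im F\<close> enters with the sign opposite to the one in the half disc identity. The two
  identities can therefore be combined to eliminate it.\<close>

lemma half_annulus_identity:
  fixes F :: "complex \<Rightarrow> complex" and k :: nat
  assumes F: "F holomorphic_on {z. norm z < \<rho> \<and> Im z > - e}"
    and "e > 0" "0 < r1" "r1 \<le> r2" "r2 < \<rho>"
  defines "D \<equiv> \<lambda>r. (integral {0..pi} (\<lambda>t. Re (F (of_real r * cis t)) * sin (real k * t))
       - integral {0..pi} (\<lambda>t. Im (F (of_real r * cis t)) * cos (real k * t))) / r ^ k"
  shows "D r2 - D r1 = - integral {r1..r2} (\<lambda>x. Re (F (of_real x)) / x ^ (k + 1))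
       - integral {r1..r2} (\<lambda>x. Re (F (- of_real x)) / (- x) ^ (k + 1))"
proof -
  \<comment> \<open>The kernel is singular at 0. Slitting along the nonpositive imaginary axis
    leaves a starlike domain, where a primitive exists, that still contains the half circles and
    both punctured real segments.\<close>
  define S where "S = {z. norm z < \<rho> \<and> Im z > - e} \<inter> - ({z. Re z = 0} \<inter> {z. Im z \<le> 0})"
  have S: "S = (ball 0 \<rho> \<inter> {z. Im z > - e}) \<inter> - ({z. Re z = 0} \<inter> {z. Im z \<le> 0})"
    by (auto simp: S_def)
  have "open S"
    unfolding S
    by (intro open_Int open_ball open_halfspace_Im_gt open_Compl closed_Int closed_halfspace_Im_le)
       (intro closed_Collect_eq continuous_intros)
  have "0 < \<rho>" using assms by linarith
  have "starlike S"
    unfolding starlike_def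
  proof (intro bexI ballI)
    let ?c = "\<i> * of_real (\<rho> / 2)"
    show c: "?c \<in> S" using \<open>0 < \<rho>\<close> \<open>e > 0\<close> by (auto simp: S_def norm_mult)
    fix z assume z: "z \<in> S"
    have conv: "convex (ball 0 \<rho> \<inter> {z. Im z > - e})"
      by (intro convex_Int convex_ball convex_halfspace_Im_gt)
    have 1: "closed_segment ?c z \<subseteq> ball 0 \<rho> \<inter> {z. Im z > - e}"
      using c z unfolding S by (intro closed_segment_subset[OF _ _ conv]) auto
    \<comment> \<open>A segment from a point above 0 on the imaginary axis meets that axis again
      only if it lies in it; then \<open>z\<close> is above 0, and so is everything in
      between.\<close>
    have 2: "w \<notin> {z. Re z = 0} \<inter> {z. Im z \<le> 0}" if w: "w \<in> closed_segment ?c z" for w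
    proof
      assume w0: "w \<in> {z. Re z = 0} \<inter> {z. Im z \<le> 0}"
      obtain u where u: "0 \<le> u" "u \<le> 1" "w = (1 - u) *\<^sub>R ?c + u *\<^sub>R z"
        using w by (auto simp: in_segment)
      have "u * Re z = 0" "(1 - u) * (\<rho> / 2) + u * Im z \<le> 0" using w0 u by auto
      then have "u \<noteq> 0" "Re z = 0" using \<open>0 < \<rho>\<close> by fastforce+
      then have "Im z > 0" using z by (auto simp: S_def)
      then have "u * Im z > 0" "(1 - u) * (\<rho> / 2) \<ge> 0" using u \<open>u \<noteq> 0\<close> \<open>0 < \<rho>\<close> by auto
      then show False using \<open>(1 - u) * (\<rho> / 2) + u * Im z \<le> 0\<close> by linarith
    qed
    show "closed_segment ?c z \<subseteq> S" using 1 2 unfolding S by blast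
  qed
  have "0 \<notin> S" by (simp add: S_def)
  have holo: "(\<lambda>z. F z / z ^ (k + 1)) holomorphic_on S"
    using \<open>0 \<notin> S\<close> by (intro holomorphic_intros holomorphic_on_subset[OF F]) (auto simp: S_def)
  have "\<exists>P. \<forall>z\<in>S. (P has_field_derivative F z / z ^ (k + 1)) (at z)"
    using holomorphic_on_imp_differentiable_at[OF holo \<open>open S\<close>]
    by (intro holomorphic_starlike_primitive[OF holomorphic_on_imp_continuous_on[OF holo]
          \<open>starlike S\<close> \<open>open S\<close> finite.emptyI]) simp
  then obtain P where P: "\<And>z. z \<in> S \<Longrightarrow> (P has_field_derivative F z / z ^ (k + 1)) (at z)"
    by auto
  have D: "D r = Re (P (- of_real r)) - Re (P (of_real r))" if r: "0 < r" "r < \<rho>" for r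
  proof -
    have arcS: "of_real r * cis t \<in> S" if t: "0 \<le> t" "t \<le> pi" for t
    proof -
      have "0 \<le> r * sin t" using t r by (simp add: sin_ge_zero)
      \<comment> \<open>The arc meets the imaginary axis only at its top, away from the
        slit.\<close>
      moreover have "cos t = 0 \<Longrightarrow> sin t > 0"
        using t sin_ge_zero[OF t] sin_zero_abs_cos_one[of t] by (cases "sin t = 0") auto
      ultimately show ?thesis using r \<open>e > 0\<close> by (auto simp: S_def norm_mult not_le)
    qed
    have cont: "continuous_on {0..pi} (\<lambda>t. F (of_real r * cis t))"
      using F arcS
      by (intro continuous_on_compose2[OF holomorphic_on_imp_continuous_on[OF F]] continuous_intros)
         (auto simp: S_def)
    have "((\<lambda>t. \<i> * (of_real r * cis t) * (F (of_real r * cis t) / (of_real r * cis t) ^ (k + 1)))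
            has_integral P (- of_real r) - P (of_real r)) {0..pi}"
      by (rule has_integral_primitive_arc[OF P arcS])
    also have "(\<lambda>t. \<i> * (of_real r * cis t) * (F (of_real r * cis t) / (of_real r * cis t) ^ (k + 1)))
        = (\<lambda>t. \<i> * F (of_real r * cis t) * cis (- (real k * t)) / of_real (r ^ k))"
    proof
      fix t
      have "\<i> * (of_real r * cis t) * (F (of_real r * cis t) / (of_real r * cis t) ^ (k + 1))
          = \<i> * F (of_real r * cis t) / (of_real r * cis t) ^ k"
        using r by simp
      also have "(of_real r * cis t) ^ k = of_real (r ^ k) * cis (real k * t)"
        by (simp add: power_mult_distrib Complex.DeMoivre)
      also have "\<i> * F (of_real r * cis t) / (of_real (r ^ k) * cis (real k * t)) =
           \<i> * F (of_real r * cis t) * cis (- (real k * t)) / of_real (r ^ k)"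
        by (simp add: cis_inverse[symmetric] field_simps)
      finally show "\<i> * (of_real r * cis t) * (F (of_real r * cis t) / (of_real r * cis t) ^ (k + 1))
        = \<i> * F (of_real r * cis t) * cis (- (real k * t)) / of_real (r ^ k)" .
    qed
    finally have arc: "((\<lambda>t. \<i> * F (of_real r * cis t) * cis (- (real k * t)) / of_real (r ^ k))
            has_integral P (- of_real r) - P (of_real r)) {0..pi}" .
    have "D r = integral {0..pi} (\<lambda>t. Re (F (of_real r * cis t)) * sin (real k * t)
           - Im (F (of_real r * cis t)) * cos (real k * t)) / r ^ k"
      unfolding D_def
      by (subst integral_diff) (intro integrable_continuous_real continuous_intros cont refl)+
    also have "\<dots> = integral {0..pi} (\<lambda>t. (Re (F (of_real r * cis t)) * sin (real k * t)
           - Im (F (of_real r * cis t)) * cos (real k * t)) / r ^ k)"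
      by simp
    also have "\<dots> = Re (P (- of_real r)) - Re (P (of_real r))"
    proof (rule integral_unique)
      have "Re (\<i> * w * cis (- s) / of_real (r ^ k)) = (Re w * sin s - Im w * cos s) / r ^ k" for w s
        unfolding Re_divide_of_real by simp
      then show "((\<lambda>t. (Re (F (of_real r * cis t)) * sin (real k * t)
             - Im (F (of_real r * cis t)) * cos (real k * t)) / r ^ k) has_integral
             Re (P (- of_real r)) - Re (P (of_real r))) {0..pi}"
        using has_integral_Re[OF arc] by (simp only: minus_complex.sel)
    qed
    finally show ?thesis .
  qed
  have realS: "of_real x \<in> S" if "x \<noteq> 0" "\<bar>x\<bar> < \<rho>" for x
    using that \<open>e > 0\<close> by (simp add: S_def)
  have right: "((\<lambda>x. F (of_real x) / of_real x ^ (k + 1)) has_integral P (of_real r2) - P (of_real r1)) {r1..r2}"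
    by (rule has_integral_primitive_real_line[OF P]) (use assms(3-5) in \<open>auto intro!: realS\<close>)
  have left: "((\<lambda>x. F (of_real x) / of_real x ^ (k + 1)) has_integral P (of_real (-r1)) - P (of_real (-r2))) {-r2..-r1}"
    by (rule has_integral_primitive_real_line[OF P]) (use assms(3-5) in \<open>auto intro!: realS\<close>)
  have "integral {r1..r2} (\<lambda>x. Re (F (of_real x)) / x ^ (k + 1)) = Re (P (of_real r2)) - Re (P (of_real r1))"
    by (rule integral_unique) (use has_integral_Re[OF right] in \<open>simp add: Re_divide_of_real flip: of_real_power of_real_mult\<close>)
  moreover have "integral {r1..r2} (\<lambda>x. Re (F (- of_real x)) / (- x) ^ (k + 1)) =
      Re (P (- of_real r1)) - Re (P (- of_real r2))"
  proof (rule integral_unique)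
    have "((\<lambda>x. Re (F (of_real x)) / x ^ (k + 1)) has_integral
             Re (P (- of_real r1)) - Re (P (- of_real r2))) {-r2..-r1}"
      using has_integral_Re[OF left] by (simp add: Re_divide_of_real flip: of_real_power of_real_mult)
    then have "((\<lambda>x. Re (F (of_real (- x))) / (- x) ^ (k + 1)) has_integral
             Re (P (- of_real r1)) - Re (P (- of_real r2))) {r1..r2}"
      by (subst (asm) has_integral_reflect_real[symmetric]) simp
    then show "((\<lambda>x. Re (F (- of_real x)) / (- x) ^ (k + 1)) has_integral
             Re (P (- of_real r1)) - Re (P (- of_real r2))) {r1..r2}"
      by simp
  qed
  ultimately show ?thesis using D[of r1] D[of r2] assms(3-5) by linarith
qed

section \<open>Passage to the boundary values\<close>

lemma continuous_on_integral_param_real: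
  fixes f :: "real \<Rightarrow> real \<Rightarrow> real"
  assumes "continuous_on (U \<times> {a..b}) (\<lambda>p. f (fst p) (snd p))"
  shows "continuous_on U (\<lambda>x. integral {a..b} (f x))"
  using integral_continuous_on_param[of U a b f] assms by (simp add: case_prod_unfold)

text \<open>Eliminating the cosine moment of the conjugate leaves 2 g(r) / r^k, an integral of the
  boundary values over [-r, r] divided by r^(2k), and weighted boundary integrals over the two
  segments between the radii. For the given datum the first integral contributes the constant 1 / (2
  k), the left segment nothing, and the right segment the logarithm.\<close>

lemma harmonic_half_disc_resonance:
  fixes F :: "complex \<Rightarrow> complex" and W :: "complex \<Rightarrow> real" and k :: nat
  assumes F: "F holomorphic_on {z. norm z < R \<and> Im z > 0}"
    and W: "continuous_on {z. norm z < R \<and> Im z \<ge> 0} W"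
    and ReF: "\<And>z. \<lbrakk>norm z < R; Im z > 0\<rbrakk> \<Longrightarrow> Re (F z) = W z"
    and bdry: "\<And>x. \<bar>x\<bar> < R \<Longrightarrow> W (of_real x) = max x 0 ^ k"
    and "k \<ge> 1" "0 < r1" "r1 \<le> r2" "r2 < R"
  defines "g \<equiv> \<lambda>r. integral {0..pi} (\<lambda>t. W (of_real r * cis t) * sin (real k * t))"
  shows "2 * (g r2 / r2 ^ k - g r1 / r1 ^ k) = ln r1 - ln r2"
proof -
  \<comment> \<open>\<open>F\<close> need not extend to the real line, so the contours are shifted by \<open>\<i> e\<close> and \<open>e \<rightarrow> 0\<close>.\<close>
  define e0 where "e0 = (R - r2) / 2"
  have "e0 > 0" using \<open>r2 < R\<close> by (simp add: e0_def)
  have R_eq: "R = r2 + e0 + e0" by (simp add: e0_def)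
  define A where "A = (\<lambda>r e. integral {0..pi} (\<lambda>t. W (of_real r * cis t + \<i> * of_real e) * sin (real k * t)))"
  define I where "I = (\<lambda>r e. integral {-r..r} (\<lambda>x. W (of_real x + \<i> * of_real e) * x ^ (k - 1)))"
  define J where "J = (\<lambda>e. integral {r1..r2} (\<lambda>x. W (of_real x + \<i> * of_real e) / x ^ (k + 1)))"
  define K where "K = (\<lambda>e. integral {r1..r2} (\<lambda>x. W (- of_real x + \<i> * of_real e) / (- x) ^ (k + 1)))"
  \<comment> \<open>\<open>E e = 0\<close> is the half annulus identity with the cosine moment
    replaced by means of the half disc identity. It involves only values of \<open>W\<close>, so it
    still makes sense at \<open>e = 0\<close>.\<close>
  define E where "E = (\<lambda>e. (2 * A r2 e - I r2 e / r2 ^ k) / r2 ^ k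
      - (2 * A r1 e - I r1 e / r1 ^ k) / r1 ^ k + J e + K e)"
  have dom: "norm (z + \<i> * of_real e) < R"
    if "norm z < r2 + e0" "0 \<le> e" "e \<le> e0" for z e
    using norm_triangle_ineq[of z "\<i> * of_real e"] that by (simp add: R_eq norm_mult)
  have arc: "norm (of_real r * cis t) < r2 + e0" "Im (of_real r * cis t) \<ge> 0"
    if "0 \<le> r" "r \<le> r2" "0 \<le> t" "t \<le> pi" for r t
    using that \<open>e0 > 0\<close> by (auto simp: norm_mult sin_ge_zero)
  have zero: "E e = 0" if e: "0 < e" "e < e0" for e
  proof -
    \<comment> \<open>After the shift the domain of holomorphy reaches below the real line, as both
      contour identities require.\<close>
    define G where "G = (\<lambda>z. F (z + \<i> * of_real e))"
    have G: "G holomorphic_on {z. norm z < r2 + e0 \<and> Im z > - e}"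
      unfolding G_def
      by (rule holomorphic_on_compose_gen[OF _ F, unfolded o_def])
         (use dom e in \<open>auto intro!: holomorphic_intros\<close>)
    have ReG: "Re (G z) = W (z + \<i> * of_real e)" if "norm z < r2 + e0" "Im z \<ge> 0" for z
      unfolding G_def using that e dom by (intro ReF) auto
    define H where "H = (\<lambda>r. integral {0..pi} (\<lambda>t. Im (G (of_real r * cis t)) * cos (real k * t)))"
    have A: "integral {0..pi} (\<lambda>t. Re (G (of_real r * cis t)) * sin (real k * t)) = A r e"
      if "0 \<le> r" "r \<le> r2" for r
      unfolding A_def using that arc by (intro integral_cong) (simp add: ReG)
    have I: "integral {-r..r} (\<lambda>x. Re (G (of_real x)) * x ^ (k - 1)) = I r e"
      if "0 \<le> r" "r \<le> r2" for r
      unfolding I_def using that \<open>e0 > 0\<close> by (intro integral_cong) (auto simp: ReG)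
    have J: "integral {r1..r2} (\<lambda>x. Re (G (of_real x)) / x ^ (k + 1)) = J e"
      unfolding J_def using assms(6-8) \<open>e0 > 0\<close> by (intro integral_cong) (auto simp: ReG)
    have K: "integral {r1..r2} (\<lambda>x. Re (G (- of_real x)) / (- x) ^ (k + 1)) = K e"
      unfolding K_def using assms(6-8) \<open>e0 > 0\<close> by (intro integral_cong) (auto simp: ReG)
    have H: "H r = I r e / r ^ k - A r e" if "0 < r" "r \<le> r2" for r
      using half_disc_sector_identity[OF G e(1) \<open>k \<ge> 1\<close>, of r] that \<open>e0 > 0\<close>
      by (simp add: A I H_def del: One_nat_def)
    have "(A r2 e - H r2) / r2 ^ k - (A r1 e - H r1) / r1 ^ k = - J e - K e"
      using half_annulus_identity[OF G e(1) \<open>0 < r1\<close> \<open>r1 \<le> r2\<close>, of k] assms(6-8) \<open>e0 > 0\<close> J K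
      by (simp add: A H_def)
    then show ?thesis using H[of r1] H[of r2] assms(6-8) by (simp add: E_def)
  qed
  \<comment> \<open>Continuity of \<open>W\<close> up to the real line gives joint continuity in the
    shift and the curve parameter, including shift 0.\<close>
  have contW: "continuous_on ({0..e0} \<times> X) (\<lambda>p. W (f (snd p) + \<i> * of_real (fst p)))"
    if "continuous_on X f" "\<And>x. x \<in> X \<Longrightarrow> norm (f x) < r2 + e0 \<and> Im (f x) \<ge> 0" for X and f :: "real \<Rightarrow> complex"
  proof (rule continuous_on_compose2[OF W])
    show "continuous_on ({0..e0} \<times> X) (\<lambda>p. f (snd p) + \<i> * of_real (fst p))"
      by (intro continuous_intros continuous_on_compose2[OF that(1)]) auto
    show "(\<lambda>p. f (snd p) + \<i> * of_real (fst p)) ` ({0..e0} \<times> X) \<subseteq> {z. norm z < R \<and> Im z \<ge> 0}"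
      using that(2) dom by auto
  qed
  have "continuous_on {0..e0} (A r)" if "0 \<le> r" "r \<le> r2" for r
    unfolding A_def
    by (intro continuous_on_integral_param_real continuous_intros contW) (use that arc in auto)
  moreover have "continuous_on {0..e0} (I r)" if "0 \<le> r" "r \<le> r2" for r
    unfolding I_def
    by (intro continuous_on_integral_param_real continuous_intros contW) (use that \<open>e0 > 0\<close> in auto)
  moreover have "continuous_on {0..e0} J"
    unfolding J_def
    by (intro continuous_on_integral_param_real continuous_intros contW) (use assms(6-8) \<open>e0 > 0\<close> in auto)
  moreover have "continuous_on {0..e0} K"
    unfolding K_def
    by (intro continuous_on_integral_param_real continuous_intros contW) (use assms(6-8) \<open>e0 > 0\<close> in auto)
  ultimately have "continuous_on {0..e0} E"
    unfolding E_def using assms(6-8) by (intro continuous_intros) auto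
  then have "E 0 = 0"
    using zero \<open>e0 > 0\<close> continuous_constant_on_closure[of "{0<..<e0}" E 0 0] by auto
  have A0: "A r 0 = g r" for r by (simp add: A_def g_def)
  \<comment> \<open>After division by \<open>r ^ k\<close> twice this no longer depends on
    \<open>r\<close>, so it cancels between the two radii.\<close>
  have I0: "I r 0 = r ^ k * r ^ k / (2 * real k)" if r: "0 < r" "r \<le> r2" for r
  proof -
    have "((\<lambda>x. W (of_real x) * x ^ (k - 1)) has_integral 0) {-r..0}"
      by (rule has_integral_eq[of _ "\<lambda>x. 0"]) (use r assms(5-8) in \<open>auto simp: bdry max_def\<close>)
    moreover have "((\<lambda>x. W (of_real x) * x ^ (k - 1)) has_integral r ^ k * r ^ k / (2 * real k)) {0..r}"
    proof (rule has_integral_eq)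
      have "((\<lambda>x. x ^ (2 * k - 1)) has_integral r ^ (2 * k) / (2 * real k) - 0 ^ (2 * k) / (2 * real k)) {0..r}"
        using r \<open>k \<ge> 1\<close>
        by (intro fundamental_theorem_of_calculus)
           (auto intro!: derivative_eq_intros simp flip: has_real_derivative_iff_has_vector_derivative)
      then show "((\<lambda>x. x ^ (2 * k - 1)) has_integral r ^ k * r ^ k / (2 * real k)) {0..r}"
        using \<open>k \<ge> 1\<close> power_add[of r k k] by (simp add: zero_power flip: mult_2)
      show "x ^ (2 * k - 1) = W (of_real x) * x ^ (k - 1)" if "x \<in> {0..r}" for x
      proof -
        have "2 * k - 1 = k + (k - 1)" using \<open>k \<ge> 1\<close> by simp
        moreover have "W (of_real x) = x ^ k" using that r assms(5-8) by (simp add: bdry)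
        ultimately show ?thesis by (simp add: power_add)
      qed
    qed
    ultimately have "((\<lambda>x. W (of_real x) * x ^ (k - 1)) has_integral 0 + r ^ k * r ^ k / (2 * real k)) {-r..r}"
      using r by (intro has_integral_combine[of "-r" 0]) auto
    then show ?thesis by (auto simp: I_def intro: integral_unique)
  qed
  \<comment> \<open>Datum times kernel is x^k / x^(k+1) = 1 / x: this is the resonance.\<close>
  have J0: "J 0 = ln r2 - ln r1"
    unfolding J_def
  proof (rule integral_unique, rule has_integral_eq)
    show "((\<lambda>x. 1 / x) has_integral ln r2 - ln r1) {r1..r2}"
      using assms(6-8)
      by (intro fundamental_theorem_of_calculus)
         (auto intro!: derivative_eq_intros simp flip: has_real_derivative_iff_has_vector_derivative)
    show "1 / x = W (of_real x + \<i> * of_real 0) / x ^ (k + 1)" if "x \<in> {r1..r2}" for x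
      using that assms(6-8) by (simp add: bdry)
  qed
  have K0: "K 0 = 0"
    unfolding K_def
  proof (rule integral_unique, rule has_integral_eq[OF _ has_integral_0])
    show "0 = W (- of_real x + \<i> * of_real 0) / (- x) ^ (k + 1)" if "x \<in> {r1..r2}" for x
      using that assms(5-8) bdry[of "- x"] by simp
  qed
  show ?thesis
    using \<open>E 0 = 0\<close> assms(6-8)
    by (simp add: E_def A0 I0 J0 K0 diff_divide_distrib)
qed

subsection \<open>Dilation differences of Barron functions\<close>

text \<open>The coefficients of \<open>(X - 2 ^ 0) (X - 2 ^ 1) \<dots> (X - 2 ^ (k - 1))\<close>: the dilations by \<open>2 ^ m\<close>
  combined with these weights annihilate homogeneous functions of degree below \<open>k\<close>, but not those of
  degree \<open>k\<close>.\<close>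

lemma geometric_difference_coefficients:
  fixes k :: nat
  obtains n :: nat and c :: "nat \<Rightarrow> real"
  where "\<And>j. j < k \<Longrightarrow> (\<Sum>m\<le>n. c m * (2 ^ m) ^ j) = 0" "(\<Sum>m\<le>n. c m * (2 ^ m) ^ k) \<noteq> 0"
proof -
  define q :: "real poly" where "q = (\<Prod>j<k. [:- (2 ^ j), 1:])"
  \<comment> \<open>Since (2^m)^j = (2^j)^m, the weighted sum is \<open>q\<close> evaluated at
    2^j.\<close>
  have eq: "(\<Sum>m\<le>degree q. coeff q m * (2 ^ m) ^ j) = (\<Prod>i<k. 2 ^ j - 2 ^ i)" for j :: nat
    using poly_altdef[of q "2 ^ j"]
    by (simp add: q_def poly_prod mult.commute[of j] flip: power_mult)
  show ?thesis
    by (rule that[of "coeff q" "degree q"]) (auto simp: eq)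
qed

text \<open>The condition on \<open>k\<close> matters at nonpositive \<open>z\<close>, because
  \<open>0 powr 0\<close> is 0 whereas \<open>0 ^ 0\<close> is 1.\<close>

lemma relu_pow_of_nat: "k \<ge> 1 \<Longrightarrow> relu_pow (real k) z = max z 0 ^ k"
  by (cases "z > 0") (auto simp: relu_pow_def powr_realpow max_def)

text \<open>The constant must be uniform in \<open>b\<close>, because a network averages over all
  biases. Either all dilated arguments are positive, or all are negative, or \<open>b\<close> is
  itself controlled by \<open>t\<close>.\<close>

lemma relu_pow_geometric_difference_bound:
  fixes k n :: nat and c :: "nat \<Rightarrow> real"
  assumes "k \<ge> 1" and c: "\<And>j. j < k \<Longrightarrow> (\<Sum>m\<le>n. c m * (2 ^ m) ^ j) = 0"
  obtains C where "C \<ge> 0" "\<And>t b. \<bar>\<Sum>m\<le>n. c m * relu_pow (real k) (2 ^ m * t + b)\<bar> \<le> C * \<bar>t\<bar> ^ k"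
proof -
  \<comment> \<open>\<open>A\<close> is the coefficient of degree \<open>k\<close> that survives
    when all arguments are positive. \<open>B\<close> serves the transitional range, where every
    argument is at most twice \<open>2 ^ n * \<bar>t\<bar>\<close>; hence the exponent
    \<open>n + 1\<close>.\<close>
  define A where "A = \<bar>\<Sum>m\<le>n. c m * (2 ^ m) ^ k\<bar>"
  define B where "B = (\<Sum>m\<le>n. \<bar>c m\<bar> * (2 ^ (n + 1)) ^ k)"
  have AB: "A \<ge> 0" "B \<ge> 0" by (auto simp: A_def B_def sum_nonneg)
  have "\<bar>\<Sum>m\<le>n. c m * relu_pow (real k) (2 ^ m * t + b)\<bar> \<le> (A + B) * \<bar>t\<bar> ^ k" for t b
  proof -
    have small: "\<bar>2 ^ m * t\<bar> \<le> 2 ^ n * \<bar>t\<bar>" if "m \<le> n" for m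
      using that by (auto simp: abs_mult intro!: mult_right_mono)
    consider "b > 2 ^ n * \<bar>t\<bar>" | "b < - (2 ^ n * \<bar>t\<bar>)" | "\<bar>b\<bar> \<le> 2 ^ n * \<bar>t\<bar>" by linarith
    then show ?thesis
    proof cases
      case 1
      have "relu_pow (real k) (2 ^ m * t + b) = (2 ^ m * t + b) ^ k" if "m \<le> n" for m
        using small[OF that] 1 \<open>k \<ge> 1\<close> by (simp add: relu_pow_of_nat)
      then have "(\<Sum>m\<le>n. c m * relu_pow (real k) (2 ^ m * t + b)) =
          (\<Sum>m\<le>n. \<Sum>j\<le>k. (real (k choose j) * t ^ j * b ^ (k - j)) * (c m * (2 ^ m) ^ j))"
        by (simp add: binomial_ring sum_distrib_left power_mult_distrib mult_ac)
      also have "\<dots> = (\<Sum>j\<le>k. (real (k choose j) * t ^ j * b ^ (k - j)) * (\<Sum>m\<le>n. c m * (2 ^ m) ^ j))"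
        by (subst sum.swap) (simp add: sum_distrib_left)
      \<comment> \<open>The only term left, j = k, carries no power of \<open>b\<close>.\<close>
      also have "\<dots> = (\<Sum>j\<in>{k}. (real (k choose j) * t ^ j * b ^ (k - j)) * (\<Sum>m\<le>n. c m * (2 ^ m) ^ j))"
        using c by (intro sum.mono_neutral_right) auto
      finally have "\<bar>\<Sum>m\<le>n. c m * relu_pow (real k) (2 ^ m * t + b)\<bar> = A * \<bar>t\<bar> ^ k"
        by (simp add: A_def abs_mult power_abs)
      then show ?thesis using AB by (simp add: distrib_right)
    next
      case 2
      have "relu_pow (real k) (2 ^ m * t + b) = 0" if "m \<le> n" for m
        using small[OF that] 2 \<open>k \<ge> 1\<close> by (simp add: relu_pow_of_nat max_def)
      then show ?thesis using AB by simp
    next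
      case 3
      have "\<bar>c m * relu_pow (real k) (2 ^ m * t + b)\<bar> \<le> \<bar>c m\<bar> * (2 ^ (n + 1)) ^ k * \<bar>t\<bar> ^ k"
        if "m \<le> n" for m
      proof -
        have "max (2 ^ m * t + b) 0 ^ k \<le> (2 ^ (n + 1) * \<bar>t\<bar>) ^ k"
          using small[OF that] 3 by (intro power_mono) auto
        then have "\<bar>c m\<bar> * max (2 ^ m * t + b) 0 ^ k \<le> \<bar>c m\<bar> * (2 ^ (n + 1) * \<bar>t\<bar>) ^ k"
          by (intro mult_left_mono) auto
        then show ?thesis
          using \<open>k \<ge> 1\<close> by (simp add: relu_pow_of_nat abs_mult power_mult_distrib mult_ac)
      qed
      then have "\<bar>\<Sum>m\<le>n. c m * relu_pow (real k) (2 ^ m * t + b)\<bar> \<le> B * \<bar>t\<bar> ^ k"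
        unfolding B_def sum_distrib_right by (intro order_trans[OF sum_abs] sum_mono) auto
      then show ?thesis using AB by (simp add: distrib_right add_increasing)
    qed
  qed
  with AB show ?thesis by (intro that[of "A + B"]) auto
qed

text \<open>The bound for one neuron, taken at \<open>t = w \<bullet> x\<close>, is at most a
  constant times |x|^k times the integrand of the cost; integration leaves the finite cost as a
  factor.\<close>

lemma network_geometric_difference_bound:
  fixes \<pi> :: "(real \<times> 'a::euclidean_space \<times> real) measure" and k n :: nat and c :: "nat \<Rightarrow> real"
  assumes "k \<ge> 1" and c: "\<And>j. j < k \<Longrightarrow> (\<Sum>m\<le>n. c m * (2 ^ m) ^ j) = 0"
    and sets: "sets \<pi> = sets borel" and fin: "barron_cost (real k) \<pi> < \<infinity>"
  obtains C where "\<And>x. \<bar>\<Sum>m\<le>n. c m * network (real k) \<pi> (2 ^ m *\<^sub>R x)\<bar> \<le> C * norm x ^ k"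
proof -
  obtain C where C: "C \<ge> 0"
    "\<And>t b. \<bar>\<Sum>m\<le>n. c m * relu_pow (real k) (2 ^ m * t + b)\<bar> \<le> C * \<bar>t\<bar> ^ k"
    using relu_pow_geometric_difference_bound[of k c n] assms by blast
  define h :: "real \<times> 'a \<times> real \<Rightarrow> real"
    where "h = (\<lambda>(a, w, b). \<bar>a\<bar> * (norm w + \<bar>b\<bar>) ^ k)"
  define g :: "'a \<Rightarrow> real \<times> 'a \<times> real \<Rightarrow> real"
    where "g = (\<lambda>x (a, w, b). a * relu_pow (real k) (w \<bullet> x + b))"
  have meas: "f \<in> borel_measurable \<pi>" if "continuous_on UNIV f" for f :: "real \<times> 'a \<times> real \<Rightarrow> real"
    using borel_measurable_continuous_onI[OF that] measurable_cong_sets[OF sets refl] by blast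
  have h_meas: "h \<in> borel_measurable \<pi>"
    unfolding h_def case_prod_unfold by (intro meas continuous_intros)
  have g_meas: "g x \<in> borel_measurable \<pi>" for x
    unfolding g_def case_prod_unfold relu_pow_of_nat[OF \<open>k \<ge> 1\<close>] by (intro meas continuous_intros)
  have h_nonneg: "h p \<ge> 0" for p by (simp add: h_def case_prod_unfold)
  have "(\<integral>\<^sup>+p. ennreal (h p) \<partial>\<pi>) = barron_cost (real k) \<pi>"
    unfolding barron_cost_def h_def case_prod_unfold
  proof (intro nn_integral_cong, goal_cases)
    case (1 p)
    have "(norm (fst (snd p)) + \<bar>snd (snd p)\<bar>) ^ k = (norm (fst (snd p)) + \<bar>snd (snd p)\<bar>) powr real k"
      using \<open>k \<ge> 1\<close> by (cases "norm (fst (snd p)) + \<bar>snd (snd p)\<bar> = 0")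
        (auto simp: powr_realpow add_nonneg_eq_0_iff powr_realpow')
    then show ?case by simp
  qed
  then have h_int: "integrable \<pi> h"
    using fin h_nonneg h_meas by (intro integrableI_nonneg) auto
  \<comment> \<open>Integrability is what lets the finite sum pass under the integral: the default
    value 0 for non-integrable functions is not additive.\<close>
  have g_int: "integrable \<pi> (g x)" for x
  proof (rule Bochner_Integration.integrable_bound)
    show "integrable \<pi> (\<lambda>p. (norm x + 1) ^ k * h p)" using h_int by simp
    show "AE p in \<pi>. norm (g x p) \<le> norm ((norm x + 1) ^ k * h p)"
    proof (intro AE_I2)
      fix p :: "real \<times> 'a \<times> real"
      obtain a w b where p: "p = (a, w, b)" by (cases p)
      have "\<bar>w \<bullet> x\<bar> \<le> norm w * norm x" by (rule Cauchy_Schwarz_ineq2)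
      then have "max (w \<bullet> x + b) 0 \<le> norm w * norm x + \<bar>b\<bar>" by (auto simp: max_def)
      also have "\<dots> \<le> (norm x + 1) * (norm w + \<bar>b\<bar>)" by (simp add: algebra_simps)
      finally have "max (w \<bullet> x + b) 0 ^ k \<le> ((norm x + 1) * (norm w + \<bar>b\<bar>)) ^ k"
        by (intro power_mono) auto
      then have "\<bar>a\<bar> * max (w \<bullet> x + b) 0 ^ k \<le> \<bar>a\<bar> * ((norm x + 1) * (norm w + \<bar>b\<bar>)) ^ k"
        by (intro mult_left_mono) auto
      then show "norm (g x p) \<le> norm ((norm x + 1) ^ k * h p)"
        using \<open>k \<ge> 1\<close> by (simp add: p g_def h_def relu_pow_of_nat abs_mult power_mult_distrib mult_ac)
    qed
  qed (rule g_meas)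
  show ?thesis
  proof
    fix x :: 'a
    have "(\<Sum>m\<le>n. c m * network (real k) \<pi> (2 ^ m *\<^sub>R x)) = (\<Sum>m\<le>n. c m * (\<integral>p. g (2 ^ m *\<^sub>R x) p \<partial>\<pi>))"
      by (simp add: network_def g_def)
    also have "\<dots> = (\<integral>p. (\<Sum>m\<le>n. c m * g (2 ^ m *\<^sub>R x) p) \<partial>\<pi>)"
      using g_int by simp
    also have "norm \<dots> \<le> (\<integral>p. norm (\<Sum>m\<le>n. c m * g (2 ^ m *\<^sub>R x) p) \<partial>\<pi>)"
      by (rule integral_norm_bound)
    also have "\<dots> \<le> (\<integral>p. C * norm x ^ k * h p \<partial>\<pi>)"
    proof (rule integral_mono)
      fix p :: "real \<times> 'a \<times> real"
      obtain a w b where p: "p = (a, w, b)" by (cases p)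
      have "(\<Sum>m\<le>n. c m * g (2 ^ m *\<^sub>R x) p) = a * (\<Sum>m\<le>n. c m * relu_pow (real k) (2 ^ m * (w \<bullet> x) + b))"
        by (simp add: p g_def sum_distrib_left mult_ac)
      then have "norm (\<Sum>m\<le>n. c m * g (2 ^ m *\<^sub>R x) p)
          = \<bar>a\<bar> * \<bar>\<Sum>m\<le>n. c m * relu_pow (real k) (2 ^ m * (w \<bullet> x) + b)\<bar>"
        by (simp add: abs_mult)
      also have "\<dots> \<le> \<bar>a\<bar> * (C * \<bar>w \<bullet> x\<bar> ^ k)" by (intro mult_left_mono C) auto
      also have "\<bar>w \<bullet> x\<bar> \<le> norm x * (norm w + \<bar>b\<bar>)"
        using Cauchy_Schwarz_ineq2[of w x] by (simp add: algebra_simps add_increasing)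
      then have "\<bar>a\<bar> * (C * \<bar>w \<bullet> x\<bar> ^ k) \<le> \<bar>a\<bar> * (C * (norm x * (norm w + \<bar>b\<bar>)) ^ k)"
        using C by (intro mult_left_mono power_mono) auto
      finally show "norm (\<Sum>m\<le>n. c m * g (2 ^ m *\<^sub>R x) p) \<le> C * norm x ^ k * h p"
        by (simp add: p h_def power_mult_distrib mult_ac)
    qed (use g_int h_int in auto)
    also have "\<dots> = C * (\<integral>p. h p \<partial>\<pi>) * norm x ^ k" by simp
    finally show "\<bar>\<Sum>m\<le>n. c m * network (real k) \<pi> (2 ^ m *\<^sub>R x)\<bar> \<le> C * (\<integral>p. h p \<partial>\<pi>) * norm x ^ k"
      by simp
  qed
qed

subsection \<open>The Dirichlet problem in the half plane\<close>

definition plane :: "complex \<Rightarrow> real^2" where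
  "plane z = Re z *\<^sub>R axis 1 1 + Im z *\<^sub>R axis 2 1"

lemma plane_nth [simp]: "plane z $ 1 = Re z" "plane z $ 2 = Im z"
  by (simp_all add: plane_def axis_def)

lemma norm_plane [simp]: "norm (plane z) = norm z"
  by (simp add: norm_vec_def L2_set_def UNIV_2 norm_complex_def)

lemma plane_scale: "plane (of_real c * z) = c *\<^sub>R plane z"
  by (simp add: plane_def scaleR_add_right)

lemma bounded_linear_plane: "bounded_linear plane"
  unfolding plane_def
  by (intro bounded_linear_add bounded_linear_scaleR_const bounded_linear_Re bounded_linear_Im
      bounded_linear_compose[OF bounded_linear_scaleR_left])

lemma continuous_on_plane [continuous_intros]: "continuous_on S plane"
  by (rule linear_continuous_on[OF bounded_linear_plane])

text \<open>Differentiability makes \<open>frechet_derivative\<close> meaningful, and linearity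
  splits it along the axes into the form of the hypotheses of
  \<open>harmonic_eq_Re_holomorphic\<close>.\<close>

lemma has_derivative_plane:
  assumes "f differentiable at (plane z)"
  shows "((\<lambda>z. f (plane z)) has_derivative
    (\<lambda>h. partial_deriv (axis 1 1) f (plane z) * Re h + partial_deriv (axis 2 1) f (plane z) * Im h)) (at z)"
proof -
  let ?D = "frechet_derivative f (at (plane z))"
  have D: "(f has_derivative ?D) (at (plane z))"
    using assms by (simp add: frechet_derivative_works)
  interpret D: bounded_linear ?D by (rule has_derivative_bounded_linear[OF D])
  have "((\<lambda>z. f (plane z)) has_derivative (\<lambda>h. ?D (plane h))) (at z)"
    by (rule has_derivative_compose[OF bounded_linear_imp_has_derivative[OF bounded_linear_plane] D])
  moreover have "?D (plane h) = partial_deriv (axis 1 1) f (plane z) * Re h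
      + partial_deriv (axis 2 1) f (plane z) * Im h" for h
    by (subst plane_def[of h]) (simp add: D.add D.scale partial_deriv_def)
  ultimately show ?thesis by simp
qed

lemma Basis_real2: "(Basis :: (real^2) set) = {axis 1 1, axis 2 1}"
  by (auto simp: Basis_vec_def UNIV_2)

lemma laplacian_real2:
  "laplacian f x = partial_deriv (axis 1 1) (partial_deriv (axis 1 1) f) x
     + partial_deriv (axis 2 1) (partial_deriv (axis 2 1) (f :: real^2 \<Rightarrow> real)) x"
  by (simp add: laplacian_def Basis_real2 axis_eq_axis)

lemma frontier_upper_half_plane: "frontier upper_half_plane = {x. x $ 2 = 0}"
  and closure_upper_half_plane: "closure upper_half_plane = {x. x $ 2 \<ge> 0}"
  and open_upper_half_plane: "open upper_half_plane"
proof -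
  show cl: "closure upper_half_plane = {x. x $ 2 \<ge> 0}"
    using closure_halfspace_component_gt[of 0 2] by (simp add: upper_half_plane_def)
  show op: "open upper_half_plane"
    unfolding upper_half_plane_def by (rule open_halfspace_component_gt_cart)
  show "frontier upper_half_plane = {x. x $ 2 = 0}"
    unfolding frontier_def cl interior_open[OF op] by (auto simp: upper_half_plane_def)
qed

lemma harmonic_plane_eq_Re_holomorphic:
  fixes u :: "real^2 \<Rightarrow> real"
  assumes "open G" "C2_on G u" and harm: "\<And>x. x \<in> G \<Longrightarrow> laplacian u x = 0"
    and S: "open S" "convex S" "plane ` S \<subseteq> G"
  obtains F where "F holomorphic_on S" "\<And>z. z \<in> S \<Longrightarrow> Re (F z) = u (plane z)"
proof -
  let ?p = "\<lambda>i. partial_deriv (axis i 1) :: (real^2 \<Rightarrow> real) \<Rightarrow> real^2 \<Rightarrow> real"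
  have C1: "C1_on G (?p i u)" for i
    using \<open>C2_on G u\<close> axis_in_Basis_iff[of i 1] by (auto simp: C2_on_def)
  have diff: "f differentiable at (plane z)" if "f differentiable_on G" "z \<in> S"
    for z and f :: "real^2 \<Rightarrow> real"
    using that S(3) \<open>open G\<close> by (auto simp: differentiable_on_eq_differentiable_at)
  have cont: "continuous_on S (\<lambda>z. ?p j (?p i u) (plane z))" for i j
  proof (rule continuous_on_compose2[OF _ continuous_on_plane S(3)])
    show "continuous_on G (?p j (?p i u))"
      using C1[of i] axis_in_Basis_iff[of j 1] by (auto simp: C1_on_def)
  qed
  show ?thesis
  proof (rule harmonic_eq_Re_holomorphic[OF S(1,2), of "\<lambda>z. u (plane z)"
        "\<lambda>z. ?p 1 u (plane z)" "\<lambda>z. ?p 2 u (plane z)"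
        "\<lambda>z. ?p 1 (?p 1 u) (plane z)" "\<lambda>z. ?p 2 (?p 1 u) (plane z)"
        "\<lambda>z. ?p 1 (?p 2 u) (plane z)" "\<lambda>z. ?p 2 (?p 2 u) (plane z)"])
    show "((\<lambda>z. u (plane z)) has_derivative (\<lambda>h. ?p 1 u (plane z) * Re h + ?p 2 u (plane z) * Im h)) (at z)"
      if "z \<in> S" for z
      using \<open>C2_on G u\<close> that by (intro has_derivative_plane diff) (auto simp: C2_on_def)
    show "((\<lambda>z. ?p i u (plane z)) has_derivative
             (\<lambda>h. ?p 1 (?p i u) (plane z) * Re h + ?p 2 (?p i u) (plane z) * Im h)) (at z)"
      if "z \<in> S" for z i
      using C1[of i] that by (intro has_derivative_plane diff) (auto simp: C1_on_def)
    then show "((\<lambda>z. ?p 2 u (plane z)) has_derivative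
             (\<lambda>h. ?p 1 (?p 2 u) (plane z) * Re h + ?p 2 (?p 2 u) (plane z) * Im h)) (at z)"
      if "z \<in> S" for z
      using that .
    show "?p 1 (?p 1 u) (plane z) + ?p 2 (?p 2 u) (plane z) = 0" if "z \<in> S" for z
      using harm[of "plane z"] that S(3) by (auto simp: laplacian_real2)
  qed (rule cont, rule cont, rule that)
qed

section \<open>Contradiction between the logarithm and the power bound\<close>

theorem corollary3p10:
  fixes k :: nat and \<Omega> :: "(real^2) set"
  assumes "k \<ge> 1" and "open \<Omega>" and "0 \<in> \<Omega>"
  shows "\<not> (\<exists>u. u \<in> barron_space (real k) (\<Omega> \<inter> upper_half_plane) \<and>
               solves_dirichlet \<Omega> upper_half_plane (\<lambda>x. relu_pow (real k) (x $ 1)) u)"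
proof
  let ?H = "upper_half_plane"
  assume "\<exists>u. u \<in> barron_space (real k) (\<Omega> \<inter> ?H) \<and>
               solves_dirichlet \<Omega> ?H (\<lambda>x. relu_pow (real k) (x $ 1)) u"
  then obtain u where u: "u \<in> barron_space (real k) (\<Omega> \<inter> ?H)"
    and sol: "solves_dirichlet \<Omega> ?H (\<lambda>x. relu_pow (real k) (x $ 1)) u" by blast
  from sol have C2: "C2_on (\<Omega> \<inter> ?H) u" and harm: "\<And>x. x \<in> \<Omega> \<inter> ?H \<Longrightarrow> laplacian u x = 0"
    by (auto simp: solves_dirichlet_def)
  from sol obtain U where U: "continuous_on (\<Omega> \<inter> closure ?H) U"
    "\<And>x. x \<in> \<Omega> \<inter> ?H \<Longrightarrow> U x = u x" "\<And>x. x \<in> \<Omega> \<inter> frontier ?H \<Longrightarrow> U x = relu_pow (real k) (x $ 1)"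
    unfolding solves_dirichlet_def by auto
  \<comment> \<open>Finiteness of the infimum yields some representing measure of finite cost; it
    need not be a minimiser.\<close>
  obtain \<pi> :: "(real \<times> (real^2) \<times> real) measure" where \<pi>: "sets \<pi> = sets borel"
    "\<And>x. x \<in> \<Omega> \<inter> ?H \<Longrightarrow> u x = network (real k) \<pi> x" "barron_cost (real k) \<pi> < \<infinity>"
    using u unfolding barron_space_def barron_norm_def by (auto simp: INF_less_iff)
  obtain n c where c: "\<And>j. j < k \<Longrightarrow> (\<Sum>m\<le>n. c m * (2 ^ m) ^ j) = 0"
    and q0: "(\<Sum>m\<le>n. c m * (2 ^ m) ^ k) \<noteq> (0 :: real)"
    using geometric_difference_coefficients[of k] by blast
  obtain C where C: "\<And>x. \<bar>\<Sum>m\<le>n. c m * network (real k) \<pi> (2 ^ m *\<^sub>R x)\<bar> \<le> C * norm x ^ k"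
    using network_geometric_difference_bound[OF \<open>k \<ge> 1\<close> c \<pi>(1,3)] by blast
  obtain R where R: "R > 0" "ball 0 R \<subseteq> \<Omega>"
    using openE[OF \<open>open \<Omega>\<close> \<open>0 \<in> \<Omega>\<close>] by blast
  have in\<Omega>: "plane z \<in> \<Omega>" if "norm z < R" for z
    using that R(2) by (auto simp: subset_iff)
  define W where "W = (\<lambda>z. U (plane z))"
  have contW: "continuous_on {z. norm z < R \<and> Im z \<ge> 0} W"
    unfolding W_def
    by (rule continuous_on_compose2[OF U(1) continuous_on_plane])
       (use in\<Omega> in \<open>auto simp: closure_upper_half_plane\<close>)
  have W_int: "W z = u (plane z)" if "norm z < R" "Im z > 0" for z
    unfolding W_def using that in\<Omega> by (intro U) (auto simp: upper_half_plane_def)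
  have W_bdry: "W (of_real x) = max x 0 ^ k" if "\<bar>x\<bar> < R" for x
    unfolding W_def relu_pow_of_nat[OF \<open>k \<ge> 1\<close>, symmetric] using that in\<Omega>[of "of_real x"]
    by (subst U) (auto simp: frontier_upper_half_plane)
  have half_disc: "{z. norm z < R \<and> Im z > 0} = ball 0 R \<inter> {z. Im z > 0}" by auto
  have "\<exists>F. F holomorphic_on {z. norm z < R \<and> Im z > 0} \<and>
      (\<forall>z. norm z < R \<and> Im z > 0 \<longrightarrow> Re (F z) = W z)"
  proof (rule harmonic_plane_eq_Re_holomorphic[OF _ C2 harm])
    show "open (\<Omega> \<inter> ?H)" using \<open>open \<Omega>\<close> open_upper_half_plane by blast
    show "open {z. norm z < R \<and> Im z > 0}"
      unfolding half_disc by (intro open_Int open_ball open_halfspace_Im_gt)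
    show "convex {z. norm z < R \<and> Im z > 0}"
      unfolding half_disc by (intro convex_Int convex_ball convex_halfspace_Im_gt)
    show "plane ` {z. norm z < R \<and> Im z > 0} \<subseteq> \<Omega> \<inter> ?H"
      using in\<Omega> by (auto simp: upper_half_plane_def)
  qed (auto simp: W_int)
  then obtain F where F: "F holomorphic_on {z. norm z < R \<and> Im z > 0}"
    "\<And>z. \<lbrakk>norm z < R; Im z > 0\<rbrakk> \<Longrightarrow> Re (F z) = W z"
    by blast
  define g where "g = (\<lambda>r. integral {0..pi} (\<lambda>t. W (of_real r * cis t) * sin (real k * t)))"
  define r0 where "r0 = R / 2"
  have r0: "0 < r0" "r0 < R" using R by (auto simp: r0_def)
  \<comment> \<open>Fixing the outer radius \<open>r0\<close> turns the resonance identity into a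
    closed formula for \<open>g\<close>, with this constant.\<close>
  define B where "B = g r0 / r0 ^ k + ln r0 / 2"
  have g_eq: "g r = r ^ k * (B - ln r / 2)" if "0 < r" "r \<le> r0" for r
  proof -
    have "2 * (g r0 / r0 ^ k - g r / r ^ k) = ln r - ln r0"
      unfolding g_def
      by (rule harmonic_half_disc_resonance[OF F(1) contW F(2) W_bdry \<open>k \<ge> 1\<close>])
         (use that r0 in auto)
    then have "g r / r ^ k = B - ln r / 2" by (simp add: B_def field_simps)
    then show ?thesis using that by (simp add: field_simps)
  qed
  have cont_arc: "continuous_on {0..pi} (\<lambda>t. W (of_real s * cis t))" if "0 < s" "s \<le> r0" for s
    by (rule continuous_on_compose2[OF contW])
       (use that r0 in \<open>auto intro!: continuous_intros simp: norm_mult sin_ge_zero\<close>)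
  \<comment> \<open>The representation is known only in the open half plane, hence
    \<open>sin t > 0\<close>; at the ends of the arc the factor \<open>sin (real k * t)\<close>
    vanishes instead.\<close>
  have W_arc: "W (of_real s * cis t) = network (real k) \<pi> (plane (of_real s * cis t))"
    if "0 < s" "s \<le> r0" "sin t > 0" for s t
  proof -
    have "norm (of_real s * cis t) < R" "Im (of_real s * cis t) > 0"
      using that r0 by (auto simp: norm_mult)
    then show ?thesis
      using W_int \<pi>(2) in\<Omega> by (simp add: upper_half_plane_def)
  qed
  define q where "q = (\<Sum>m\<le>n. c m * (2 ^ m) ^ k)"
  \<comment> \<open>Collects the shifts in ln(2^m r) = ln r + m ln 2; it does not depend on
    \<open>r\<close>.\<close>
  define D where "D = (\<Sum>m\<le>n. c m * (2 ^ m) ^ k * (real m * ln 2 / 2))"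
  \<comment> \<open>Both sides come from the same combination of moments, divided by
    \<open>r ^ k\<close>: the closed formula gives the left side, the network bound on an arc of
    angle pi the right. The second condition on \<open>r\<close> keeps all dilates within radius
    \<open>r0\<close>.\<close>
  have key: "\<bar>(B - ln r / 2) * q - D\<bar> \<le> pi * C" if r: "0 < r" "2 ^ n * r \<le> r0" for r
  proof -
    have small: "0 < 2 ^ m * r" "2 ^ m * r \<le> r0" if "m \<le> n" for m
    proof -
      have "2 ^ m * r \<le> 2 ^ n * r" using that r by (intro mult_right_mono power_increasing) auto
      then show "2 ^ m * r \<le> r0" using r by linarith
    qed (use r in auto)
    have "(\<Sum>m\<le>n. c m * g (2 ^ m * r))
        = (\<Sum>m\<le>n. c m * ((2 ^ m) ^ k * r ^ k * (B - ln r / 2 - real m * ln 2 / 2)))"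
    proof (intro sum.cong refl)
      fix m assume "m \<in> {..n}"
      moreover have "ln (2 ^ m * r) = real m * ln 2 + ln r"
        using r by (simp add: ln_mult ln_realpow)
      ultimately show "c m * g (2 ^ m * r) = c m * ((2 ^ m) ^ k * r ^ k * (B - ln r / 2 - real m * ln 2 / 2))"
        using small by (simp add: g_eq power_mult_distrib add_divide_distrib algebra_simps)
    qed
    also have "\<dots> = r ^ k * ((B - ln r / 2) * q - D)"
      unfolding q_def D_def sum_distrib_left sum_subtractf[symmetric]
      by (intro sum.cong refl) (simp add: algebra_simps)
    finally have 1: "(\<Sum>m\<le>n. c m * g (2 ^ m * r)) = r ^ k * ((B - ln r / 2) * q - D)" .
    define f where "f = (\<lambda>t. (\<Sum>m\<le>n. c m * W (of_real (2 ^ m * r) * cis t)) * sin (real k * t))"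
    have "(\<Sum>m\<le>n. c m * g (2 ^ m * r)) =
        (\<Sum>m\<le>n. integral {0..pi} (\<lambda>t. c m * (W (of_real (2 ^ m * r) * cis t) * sin (real k * t))))"
      by (simp add: g_def)
    also have "\<dots> = integral {0..pi} (\<lambda>t. \<Sum>m\<le>n. c m * (W (of_real (2 ^ m * r) * cis t) * sin (real k * t)))"
      by (intro integral_sum[symmetric] integrable_continuous_real continuous_intros cont_arc small) auto
    also have "\<dots> = integral {0..pi} f"
      unfolding f_def by (simp add: sum_distrib_right mult.assoc)
    finally have 2: "(\<Sum>m\<le>n. c m * g (2 ^ m * r)) = integral {0..pi} f" .
    have cont_f: "continuous_on {0..pi} f"
      unfolding f_def by (intro continuous_intros cont_arc small) auto
    have f_bound: "norm (f t) \<le> C * r ^ k" if t: "t \<in> {0..pi}" for t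
    proof (cases "t = 0 \<or> t = pi")
      case True
      then have "f t = 0" by (auto simp: f_def)
      \<comment> \<open>\<open>C\<close> comes without a sign; nonnegativity of
        \<open>C * r ^ k\<close> is read off from its bound at one point of norm
        \<open>r\<close>.\<close>
      moreover have "norm (plane (of_real r)) = r" using r by simp
      then have "0 \<le> C * r ^ k" using C[of "plane (of_real r)"] by (simp only:)
      ultimately show ?thesis by simp
    next
      case False
      then have "sin t > 0" using t by (intro sin_gt_zero) auto
      have "W (of_real (2 ^ m * r) * cis t) = network (real k) \<pi> (2 ^ m *\<^sub>R plane (of_real r * cis t))"
        if "m \<le> n" for m
      proof -
        have "plane (of_real (2 ^ m * r) * cis t) = 2 ^ m *\<^sub>R plane (of_real r * cis t)"
          using plane_scale[of "2 ^ m" "of_real r * cis t"] by (simp add: mult.assoc)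
        then show ?thesis using W_arc[OF small[OF that] \<open>sin t > 0\<close>] by simp
      qed
      then have "(\<Sum>m\<le>n. c m * W (of_real (2 ^ m * r) * cis t)) =
          (\<Sum>m\<le>n. c m * network (real k) \<pi> (2 ^ m *\<^sub>R plane (of_real r * cis t)))"
        by (intro sum.cong) auto
      moreover have "norm (plane (of_real r * cis t)) = r" using r by (simp add: norm_mult)
      ultimately have "\<bar>\<Sum>m\<le>n. c m * W (of_real (2 ^ m * r) * cis t)\<bar> \<le> C * r ^ k"
        using C[of "plane (of_real r * cis t)"] by simp
      moreover have "\<bar>sin (real k * t)\<bar> \<le> 1" by simp
      ultimately have "\<bar>\<Sum>m\<le>n. c m * W (of_real (2 ^ m * r) * cis t)\<bar> * \<bar>sin (real k * t)\<bar> \<le> C * r ^ k * 1"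
        by (intro mult_mono) auto
      then show ?thesis by (simp add: f_def abs_mult)
    qed
    have "norm (integral {0..pi} f) \<le> integral {0..pi} (\<lambda>t. C * r ^ k)"
      by (intro integral_norm_bound_integral f_bound integrable_continuous_real cont_f continuous_on_const)
    moreover have "norm (integral {0..pi} f) = r ^ k * \<bar>(B - ln r / 2) * q - D\<bar>"
      unfolding 2[symmetric] 1 real_norm_def abs_mult using r by simp
    ultimately have "r ^ k * \<bar>(B - ln r / 2) * q - D\<bar> \<le> r ^ k * (pi * C)"
      by (simp add: mult_ac)
    then show ?thesis using r by simp
  qed
  define M where "M = pi * C + \<bar>D\<bar> + \<bar>B * q\<bar>"
  \<comment> \<open>The first summand makes \<open>exp (- X)\<close> an admissible radius; the
    second forces \<open>X * \<bar>q\<bar> / 2\<close> to be at least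
    \<open>\<bar>M\<bar> + 1\<close>, whereas \<open>key\<close> bounds it by
    \<open>M\<close>.\<close>
  define X where "X = \<bar>ln (r0 / 2 ^ n)\<bar> + 2 * (\<bar>M\<bar> + 1) / \<bar>q\<bar>"
  have "\<bar>q\<bar> > 0" using q0 by (simp add: q_def)
  have "2 * (\<bar>M\<bar> + 1) / \<bar>q\<bar> \<le> X" by (simp add: X_def)
  then have "2 * (\<bar>M\<bar> + 1) \<le> X * \<bar>q\<bar>" using \<open>\<bar>q\<bar> > 0\<close> by (simp add: field_simps)
  have "0 \<le> 2 * (\<bar>M\<bar> + 1) / \<bar>q\<bar>" by simp
  then have "- X \<le> ln (r0 / 2 ^ n)" unfolding X_def by linarith
  then have "exp (- X) \<le> r0 / 2 ^ n" using r0 by (simp add: ln_ge_iff)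
  then have bound: "\<bar>(B + X / 2) * q - D\<bar> \<le> pi * C"
    using key[of "exp (- X)"] by (simp add: field_simps)
  have "X * \<bar>q\<bar> / 2 \<le> \<bar>X / 2 * q\<bar>" by (simp add: abs_mult mult_right_mono)
  also have "\<dots> \<le> \<bar>(B + X / 2) * q - D\<bar> + \<bar>D\<bar> + \<bar>B * q\<bar>"
    unfolding distrib_right by linarith
  also have "\<dots> \<le> M" unfolding M_def by (intro add_right_mono bound)
  finally have "2 * (\<bar>M\<bar> + 1) \<le> 2 * M"
    using \<open>2 * (\<bar>M\<bar> + 1) \<le> X * \<bar>q\<bar>\<close> by simp
  then show False by simp
qed

end
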